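(* The set of prime elements of $\mathbb{Z}[j]$ contained in $\mathcal{D}$ is $\{u(1\pm j) : u \text{ is a unit of } \mathbb{Z}[j]\}$, while the set of prime elements of $\mathbb{Z}[j]$ contained in $\mathbb{Z}[j]\setminus\mathcal{D}$ is $\{u((x+1)\pm jx) : u \text{ is a unit of } \mathbb{Z}[j],\ x\in\mathbb{Z}, \text{ and } 2x+1 \text{ is prime in } \mathbb{Z}\}$.
   Context: $\mathbb{Z}[j]$ denotes the commutative ring of formal expressions $x+jy$ with $x,y\in\mathbb{Z}$, with componentwise addition and multiplication determined by distributivity and $j^2=1$; that is, $\mathbb{Z}[j]\cong\mathbb{Z}[X]/(X^2-1)$. $\mathcal{D}=\{x\pm jx : x\in\mathbb{Z}\}$ is its set of zero divisors (including $0$). An element $p$ of a commutative ring is prime if it is non-zero, not a unit, and $p\mid xy$ implies $p\mid x$ or $p\mid y$; in particular "prime in $\mathbb{Z}$" is understood up to sign (negatives of prime numbers are allowed). *)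

theory Defs
  imports "HOL-Computational_Algebra.Factorial_Ring"
begin

datatype split_int = Split_Int (fst_part: int) (snd_part: int)

instantiation split_int :: comm_ring_1
begin

definition zero_split_int :: split_int where
  "0 = Split_Int 0 0"

definition one_split_int :: split_int where
  "1 = Split_Int 1 0"

definition plus_split_int :: "split_int \<Rightarrow> split_int \<Rightarrow> split_int" where
  "z + w = Split_Int (fst_part z + fst_part w) (snd_part z + snd_part w)"

definition uminus_split_int :: "split_int \<Rightarrow> split_int" where
  "- z = Split_Int (- fst_part z) (- snd_part z)"

definition minus_split_int :: "split_int \<Rightarrow> split_int \<Rightarrow> split_int" where
  "z - w = Split_Int (fst_part z - fst_part w) (snd_part z - snd_part w)"

(* (a + j b) (c + j d) = (a c + b d) + j (a d + b c), because j^2 = 1 *)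
definition times_split_int :: "split_int \<Rightarrow> split_int \<Rightarrow> split_int" where
  "z * w = Split_Int (fst_part z * fst_part w + snd_part z * snd_part w)
                     (fst_part z * snd_part w + snd_part z * fst_part w)"

instance
  by standard
     (simp_all add: zero_split_int_def one_split_int_def plus_split_int_def
        uminus_split_int_def minus_split_int_def times_split_int_def algebra_simps)

end

definition jj :: split_int where
  "jj = Split_Int 0 1"

lemma jj_square: "jj * jj = 1"
  by (simp add: jj_def one_split_int_def times_split_int_def)

lemma of_int_split_int: "of_int x = Split_Int x 0"
proof -
  have nat: "of_nat n = Split_Int (int n) 0" for n
    by (induction n) (simp_all add: zero_split_int_def one_split_int_def plus_split_int_def)
  show ?thesis
    by (cases x rule: int_diff_cases) (simp add: nat minus_split_int_def)
qed

lemma Split_Int_eq: "Split_Int x y = of_int x + jj * of_int y"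
  by (simp add: of_int_split_int jj_def plus_split_int_def times_split_int_def)

definition zero_divs :: "split_int set" where
  "zero_divs = {of_int x + jj * of_int x | x. True} \<union> {of_int x - jj * of_int x | x. True}"

lemma zero_divs_iff: "z \<in> zero_divs \<longleftrightarrow> (\<exists>w. w \<noteq> 0 \<and> z * w = 0)"
proof -
  obtain a b where z: "z = Split_Int a b" by (cases z)
  have mem: "z \<in> zero_divs \<longleftrightarrow> a = b \<or> a = - b"
    by (auto simp: zero_divs_def z of_int_split_int jj_def plus_split_int_def
        minus_split_int_def times_split_int_def)
  have "\<exists>w. w \<noteq> 0 \<and> z * w = 0" if "a = b"
    using that by (intro exI[of _ "Split_Int 1 (- 1)"]) (simp add: z zero_split_int_def times_split_int_def)
  moreover have "\<exists>w. w \<noteq> 0 \<and> z * w = 0" if "a = - b"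
    using that by (intro exI[of _ "Split_Int 1 1"]) (simp add: z zero_split_int_def times_split_int_def)
  moreover have "a = b \<or> a = - b" if w: "w \<noteq> 0" "z * w = 0" for w
  proof -
    obtain c d where cd: "w = Split_Int c d" by (cases w)
    have e: "a * c + b * d = 0" "a * d + b * c = 0"
      using w(2) by (simp_all add: z cd zero_split_int_def times_split_int_def)
    have "(a + b) * (c + d) = 0" "(a - b) * (c - d) = 0"
      using e by (simp_all add: algebra_simps)
    moreover have "c \<noteq> 0 \<or> d \<noteq> 0"
      using w(1) by (auto simp: cd zero_split_int_def)
    ultimately show ?thesis by auto
  qed
  ultimately show ?thesis using mem by blast
qed

end

theory Submission
  imports Defs
begin

text \<open>
  The map \<open>a + b j \<mapsto> (a + b, a - b)\<close> identifies \<open>\<int>[j]\<close> with the ring of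
  pairs of integers of equal parity, in which the zero divisors are the pairs with a vanishing
  component. The multiples of \<open>1 + j = (2, 0)\<close> are all pairs with second component \<open>0\<close>,
  and for odd \<open>q\<close> the multiples of \<open>(q, 1)\<close> are all pairs whose first component is
  divisible by \<open>q\<close>; both descriptions make primality visible. Conversely, a prime
  \<open>(s, 0)\<close> divides \<open>(s/2, s/2) (2, 0)\<close>, which forces \<open>s = \<plusminus>2\<close>. If
  \<open>s d \<noteq> 0\<close> and \<open>(s, d)\<close> is prime, then \<open>s\<close> and \<open>d\<close> cannot be even because
  \<open>(s, d)\<close> divides \<open>0 = (s, 0) (0, d)\<close>, and the factorisation
  \<open>(s, d) = (s, 1) (1, d)\<close> shows that one of the components is \<open>\<plusminus>1\<close>.
\<close>

section \<open>Coordinates by pairs of integers\<close>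

definition comp_plus :: "split_int \<Rightarrow> int" where
  "comp_plus z = fst_part z + snd_part z"

definition comp_minus :: "split_int \<Rightarrow> int" where
  "comp_minus z = fst_part z - snd_part z"

text \<open>This automorphism swaps the two components, so each result needs a direct proof for one
  component only.\<close>

definition conj_split :: "split_int \<Rightarrow> split_int" where
  "conj_split z = Split_Int (fst_part z) (- snd_part z)"

lemma comp_simps [simp]:
  "comp_plus (z * w) = comp_plus z * comp_plus w"
  "comp_minus (z * w) = comp_minus z * comp_minus w"
  "comp_plus (z + w) = comp_plus z + comp_plus w"
  "comp_minus (z + w) = comp_minus z + comp_minus w"
  "comp_plus (- z) = - comp_plus z" "comp_minus (- z) = - comp_minus z"
  "comp_plus (z - w) = comp_plus z - comp_plus w"
  "comp_minus (z - w) = comp_minus z - comp_minus w"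
  "comp_plus 0 = 0" "comp_minus 0 = 0" "comp_plus 1 = 1" "comp_minus 1 = 1"
  "comp_plus jj = 1" "comp_minus jj = - 1"
  "comp_plus (of_int x) = x" "comp_minus (of_int x) = x"
  "comp_plus (conj_split z) = comp_minus z" "comp_minus (conj_split z) = comp_plus z"
  by (simp_all add: comp_plus_def comp_minus_def conj_split_def times_split_int_def
      plus_split_int_def minus_split_int_def uminus_split_int_def zero_split_int_def one_split_int_def jj_def
      of_int_split_int algebra_simps)

lemma split_int_eq_iff: "z = w \<longleftrightarrow> comp_plus z = comp_plus w \<and> comp_minus z = comp_minus w"
  by (cases z; cases w) (auto simp: comp_plus_def comp_minus_def)

lemma comp_parity: "even (comp_plus z) \<longleftrightarrow> even (comp_minus z)"
  by (simp add: comp_plus_def comp_minus_def)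

lemma obtain_split_int:
  assumes "even s \<longleftrightarrow> even d"
  obtains z where "comp_plus z = s" "comp_minus z = d"
proof -
  have "even (s - d)" using assms by simp
  then obtain k where "s - d = 2 * k" by blast
  then have k: "s = d + 2 * k" by simp
  show thesis
    by (rule that[of "Split_Int (d + k) k"]) (use k in \<open>simp_all add: comp_plus_def comp_minus_def\<close>)
qed

text \<open>A quotient computed componentwise lies in the ring exactly when its components have
  equal parity.\<close>

lemma dvd_split_int_iff:
  "z dvd w \<longleftrightarrow> (\<exists>s d. (even s \<longleftrightarrow> even d) \<and> comp_plus w = comp_plus z * s
     \<and> comp_minus w = comp_minus z * d)"
proof
  assume "z dvd w"
  then show "\<exists>s d. (even s \<longleftrightarrow> even d) \<and> comp_plus w = comp_plus z * s \<and> comp_minus w = comp_minus z * d"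
    by (metis comp_parity comp_simps(1,2) dvdE)
next
  assume "\<exists>s d. (even s \<longleftrightarrow> even d) \<and> comp_plus w = comp_plus z * s \<and> comp_minus w = comp_minus z * d"
  then obtain s d where sd: "even s \<longleftrightarrow> even d" "comp_plus w = comp_plus z * s" "comp_minus w = comp_minus z * d"
    by blast
  obtain v where "comp_plus v = s" "comp_minus v = d"
    using obtain_split_int[OF sd(1)] .
  with sd have "w = z * v" by (simp add: split_int_eq_iff)
  then show "z dvd w" by simp
qed

lemma dvd_imp_comp_dvd:
  assumes "z dvd w"
  shows "comp_plus z dvd comp_plus w" "comp_minus z dvd comp_minus w"
  using assms by (auto simp: dvd_split_int_iff)

lemma unit_split_int_iff: "u dvd 1 \<longleftrightarrow> \<bar>comp_plus u\<bar> = 1 \<and> \<bar>comp_minus u\<bar> = 1"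
proof
  assume "u dvd 1"
  then show "\<bar>comp_plus u\<bar> = 1 \<and> \<bar>comp_minus u\<bar> = 1"
    using dvd_imp_comp_dvd[of u 1] by simp
next
  assume u: "\<bar>comp_plus u\<bar> = 1 \<and> \<bar>comp_minus u\<bar> = 1"
  then have "u * u = 1"
    by (auto simp: split_int_eq_iff abs_if split: if_splits)
  then show "u dvd 1" by (metis dvd_triv_left)
qed

lemma zero_divs_comp_iff: "z \<in> zero_divs \<longleftrightarrow> comp_plus z = 0 \<or> comp_minus z = 0"
proof
  assume "z \<in> zero_divs"
  then show "comp_plus z = 0 \<or> comp_minus z = 0" by (auto simp: zero_divs_def)
next
  assume "comp_plus z = 0 \<or> comp_minus z = 0"
  moreover have "comp_plus z + comp_minus z = 2 * fst_part z"
    by (simp add: comp_plus_def comp_minus_def)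
  ultimately have "z = of_int (fst_part z) + jj * of_int (fst_part z)
      \<or> z = of_int (fst_part z) - jj * of_int (fst_part z)"
    by (auto simp: split_int_eq_iff)
  then show "z \<in> zero_divs" unfolding zero_divs_def by blast
qed

lemma conj_split_conj_split [simp]: "conj_split (conj_split z) = z"
  by (simp add: split_int_eq_iff)

lemma conj_split_mult: "conj_split (z * w) = conj_split z * conj_split w"
  by (simp add: split_int_eq_iff)

lemma conj_split_dvd_iff: "conj_split z dvd w \<longleftrightarrow> z dvd conj_split w"
  by (auto simp: dvd_split_int_iff)

lemma prime_elem_conj_split:
  assumes "prime_elem p"
  shows "prime_elem (conj_split p)"
proof (rule prime_elemI)
  show "conj_split p \<noteq> 0"
    using assms by (auto simp: prime_elem_def split_int_eq_iff)
  show "\<not> conj_split p dvd 1"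
    using assms by (auto simp: prime_elem_def unit_split_int_iff)
  show "conj_split p dvd a \<or> conj_split p dvd b" if "conj_split p dvd a * b" for a b
    using assms that by (simp add: conj_split_dvd_iff conj_split_mult prime_elem_dvd_mult_iff)
qed

lemma prime_elem_conj_split_iff: "prime_elem (conj_split p) \<longleftrightarrow> prime_elem p"
  by (metis prime_elem_conj_split conj_split_conj_split)

section \<open>Primality read off from the components\<close>

lemma prime_elem_iff_comp_minus_0:
  assumes 0: "comp_minus p = 0"
  shows "prime_elem p \<longleftrightarrow> \<bar>comp_plus p\<bar> = 2"
proof
  assume p: "prime_elem p"
  obtain x where x: "comp_plus p = 2 * x"
    using comp_parity[of p] 0 by auto
  then have "p = of_int x * (1 + jj)"
    using 0 by (simp add: split_int_eq_iff)
  moreover have "x \<noteq> 0"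
    using p x 0 by (auto simp: prime_elem_def split_int_eq_iff)
  then have "\<not> p dvd of_int x"
    using dvd_imp_comp_dvd(2)[of p "of_int x"] 0 by auto
  ultimately have "p dvd 1 + jj"
    using p by (metis dvd_refl prime_elem_dvd_mult_iff)
  \<comment> \<open>In first components, \<open>2 * x\<close> divides 2.\<close>
  then have "x dvd 1"
    using dvd_imp_comp_dvd(1)[of p "1 + jj"] x by simp
  then show "\<bar>comp_plus p\<bar> = 2" using x by simp
next
  assume p: "\<bar>comp_plus p\<bar> = 2"
  have dvd: "p dvd w \<longleftrightarrow> comp_minus w = 0" for w
  proof
    assume w: "comp_minus w = 0"
    then have "comp_plus p dvd comp_plus w"
      using p comp_parity[of w] by (metis abs_dvd_iff even_zero)
    then obtain s where "comp_plus w = comp_plus p * s" by blast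
    \<comment> \<open>As \<open>comp_minus p = 0\<close>, the second component of the quotient is
      free and can be given the parity of \<open>s\<close>.\<close>
    then show "p dvd w" using w 0 by (auto simp: dvd_split_int_iff)
  qed (use dvd_imp_comp_dvd(2)[of p w] 0 in simp)
  show "prime_elem p"
    by (rule prime_elemI) (use p in \<open>auto simp: dvd\<close>)
qed

lemma prime_elem_iff_comp_plus_0:
  assumes "comp_plus p = 0"
  shows "prime_elem p \<longleftrightarrow> \<bar>comp_minus p\<bar> = 2"
  using prime_elem_iff_comp_minus_0[of "conj_split p"] assms by (simp add: prime_elem_conj_split_iff)

text \<open>Divisibility by \<open>p\<close> depends on first components only, and
  \<open>comp_plus\<close> is a ring homomorphism onto the integers, so primality transfers both
  ways.\<close>

lemma prime_elem_iff_comp_minus_1: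
  assumes m: "\<bar>comp_minus p\<bar> = 1"
  shows "prime_elem p \<longleftrightarrow> prime_elem (comp_plus p)"
proof -
  have "odd (comp_minus p)" using m by (auto simp: abs_if split: if_splits)
  then have odd: "odd (comp_plus p)" by (simp add: comp_parity)
  have dvd: "p dvd w \<longleftrightarrow> comp_plus p dvd comp_plus w" for w
  proof
    assume "comp_plus p dvd comp_plus w"
    then obtain s where s: "comp_plus w = comp_plus p * s" by blast
    \<comment> \<open>The sign \<open>comp_minus p\<close> is its own inverse, which gives the
      second component of the quotient. Parities agree because both components of \<open>p\<close>
      are odd.\<close>
    have "comp_minus w = comp_minus p * (comp_minus p * comp_minus w)"
      using m by (auto simp: abs_if split: if_splits)
    moreover have "even s \<longleftrightarrow> even (comp_minus p * comp_minus w)"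
      using s odd comp_parity[of w] comp_parity[of p] by auto
    ultimately show "p dvd w" using s unfolding dvd_split_int_iff by blast
  qed (rule dvd_imp_comp_dvd)
  have nz: "p \<noteq> 0" using m by auto
  have "comp_plus p \<noteq> 0" using odd by auto
  have "prime_elem (comp_plus p)" if p: "prime_elem p"
  proof (rule prime_elemI)
    show "comp_plus p dvd a \<or> comp_plus p dvd b" if "comp_plus p dvd a * b" for a b
    proof -
      have "p dvd of_int a * of_int b" using that by (simp add: dvd)
      then show ?thesis using prime_elem_dvd_multD[OF p] by (fastforce simp: dvd)
    qed
    show "\<not> comp_plus p dvd 1" using p dvd[of 1] by (auto simp: prime_elem_def)
  qed fact
  moreover have "prime_elem p" if q: "prime_elem (comp_plus p)"
  proof (rule prime_elemI)
    show "\<not> p dvd 1" using prime_elem_not_unit[OF q] by (simp add: dvd)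
    show "p dvd a \<or> p dvd b" if "p dvd a * b" for a b
      using prime_elem_dvd_multD[OF q] that by (simp add: dvd)
  qed fact
  ultimately show ?thesis by blast
qed

lemma prime_elem_iff_comp_plus_1:
  assumes "\<bar>comp_plus p\<bar> = 1"
  shows "prime_elem p \<longleftrightarrow> prime_elem (comp_minus p)"
  using prime_elem_iff_comp_minus_1[of "conj_split p"] assms by (simp add: prime_elem_conj_split_iff)

lemma prime_elem_comp_unit:
  assumes p: "prime_elem p" and s: "comp_plus p \<noteq> 0" and d: "comp_minus p \<noteq> 0"
  shows "\<bar>comp_plus p\<bar> = 1 \<or> \<bar>comp_minus p\<bar> = 1"
proof -
  have odd: "odd (comp_plus p)"
  proof
    assume even: "even (comp_plus p)"
    obtain v where v: "comp_plus v = comp_plus p" "comp_minus v = 0"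
      using even obtain_split_int[of "comp_plus p" 0] by auto
    obtain w where w: "comp_plus w = 0" "comp_minus w = comp_minus p"
      using even comp_parity[of p] obtain_split_int[of 0 "comp_minus p"] by auto
    have "v * w = 0" using v w by (simp add: split_int_eq_iff)
    then have "p dvd v \<or> p dvd w" using p by (metis dvd_0_right prime_elem_dvd_mult_iff)
    \<comment> \<open>The quotient would have to be (1, 0) or (0, 1), and parity excludes
      both.\<close>
    then show False using v w s d by (auto simp: dvd_split_int_iff)
  qed
  obtain v where v: "comp_plus v = comp_plus p" "comp_minus v = 1"
    using odd obtain_split_int[of "comp_plus p" 1] by auto
  obtain w where w: "comp_plus w = 1" "comp_minus w = comp_minus p"
    using odd comp_parity[of p] obtain_split_int[of 1 "comp_minus p"] by auto
  have "p = v * w" using v w by (simp add: split_int_eq_iff)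
  then have "p dvd v \<or> p dvd w" using p by (metis dvd_refl prime_elem_dvd_mult_iff)
  \<comment> \<open>If \<open>p\<close> divides \<open>v\<close>, then \<open>comp_minus p\<close>
    divides 1; if \<open>p\<close> divides \<open>w\<close>, then \<open>comp_plus p\<close> divides
    1.\<close>
  then show ?thesis
    using v w dvd_imp_comp_dvd[of p v] dvd_imp_comp_dvd[of p w] by auto
qed

section \<open>The families of associates in components\<close>

lemma associates_of_1_plus_jj:
  "{u * (1 + jj) | u. u dvd 1} = {p. comp_minus p = 0 \<and> \<bar>comp_plus p\<bar> = 2}" (is "?L = ?R")
proof
  show "?L \<subseteq> ?R" by (auto simp: unit_split_int_iff abs_mult)
  show "?R \<subseteq> ?L"
  proof
    fix p assume "p \<in> ?R"
    then have "p = 1 * (1 + jj) \<or> p = - 1 * (1 + jj)"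
      by (auto simp: split_int_eq_iff abs_if split: if_splits)
    then show "p \<in> ?L" using dvd_refl[of "1 :: split_int"] by fastforce
  qed
qed

text \<open>The element multiplied by \<open>u\<close> has components \<open>2 * x + 1\<close> and
  1, and a unit changes only their signs.\<close>

lemma associates_of_primes_plus:
  "{u * (of_int (x + 1) + jj * of_int x) | u x. u dvd 1 \<and> prime_elem (2 * x + 1 :: int)} =
     {p. \<bar>comp_minus p\<bar> = 1 \<and> prime_elem (comp_plus p)}" (is "?L = ?R")
proof
  show "?L \<subseteq> ?R"
  proof
    fix p assume "p \<in> ?L"
    then obtain u x where p: "p = u * (of_int (x + 1) + jj * of_int x)" "u dvd 1" "prime_elem (2 * x + 1)"
      by blast
    then have "\<bar>comp_minus p\<bar> = 1"
      by (simp add: unit_split_int_iff abs_mult)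
    moreover have "comp_plus p = comp_plus u * (2 * x + 1)"
      using p(1) by simp
    then have "prime_elem (comp_plus p)"
      using p(2,3) by (simp add: unit_split_int_iff prime_elem_mult_unit_left)
    ultimately show "p \<in> ?R" by simp
  qed
  show "?R \<subseteq> ?L"
  proof
    fix p assume p: "p \<in> ?R"
    then have "odd (comp_minus p)" by (auto simp: abs_if split: if_splits)
    then have "odd (comp_minus p * comp_plus p)" by (simp add: comp_parity)
    \<comment> \<open>Multiplying \<open>p\<close> by the sign \<open>comp_minus p\<close> makes its
      second component 1; \<open>x\<close> is read off from the resulting first component.\<close>
    then obtain x where x: "comp_minus p * comp_plus p = 2 * x + 1" by (rule oddE)
    let ?u = "of_int (comp_minus p) :: split_int"
    have "p = ?u * (of_int (x + 1) + jj * of_int x)"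
      using p x by (auto simp: split_int_eq_iff abs_if split: if_splits)
    moreover have "?u dvd 1" using p by (simp add: unit_split_int_iff)
    moreover have "prime_elem (2 * x + 1)"
      unfolding x[symmetric] using p by (simp add: prime_elem_mult_unit_left)
    ultimately show "p \<in> ?L" by blast
  qed
qed

lemma conj_split_unit_iff: "conj_split u dvd 1 \<longleftrightarrow> u dvd 1"
  by (auto simp: unit_split_int_iff)

text \<open>Conjugation permutes the units; this carries the two descriptions with
  \<open>+ jj\<close> over to those with \<open>- jj\<close>.\<close>

lemma associate_conj_split_iff:
  "(\<exists>u. conj_split p = u * z \<and> u dvd 1) \<longleftrightarrow> (\<exists>u. p = u * conj_split z \<and> u dvd 1)"
  by (metis conj_split_conj_split conj_split_mult conj_split_unit_iff)

lemma associates_of_1_minus_jj: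
  "{u * (1 - jj) | u. u dvd 1} = {p. comp_plus p = 0 \<and> \<bar>comp_minus p\<bar> = 2}"
proof -
  have "conj_split (1 + jj) = 1 - jj" by (simp add: split_int_eq_iff)
  then have "p \<in> {u * (1 - jj) | u. u dvd 1} \<longleftrightarrow> conj_split p \<in> {u * (1 + jj) | u. u dvd 1}" for p
    using associate_conj_split_iff[of p "1 + jj"] by simp
  then show ?thesis unfolding associates_of_1_plus_jj by auto
qed

lemma associates_of_primes_minus:
  "{u * (of_int (x + 1) - jj * of_int x) | u x. u dvd 1 \<and> prime_elem (2 * x + 1 :: int)} =
     {p. \<bar>comp_plus p\<bar> = 1 \<and> prime_elem (comp_minus p)}" (is "?L = _")
proof -
  have "conj_split (of_int (x + 1) + jj * of_int x) = of_int (x + 1) - jj * of_int x" for x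
    by (simp add: split_int_eq_iff)
  then have "p \<in> ?L \<longleftrightarrow> conj_split p \<in> {u * (of_int (x + 1) + jj * of_int x) | u x.
      u dvd 1 \<and> prime_elem (2 * x + 1 :: int)}" for p
    using associate_conj_split_iff[of p "of_int (_ + 1) + jj * of_int _"]
    unfolding mem_Collect_eq by metis
  then show ?thesis unfolding associates_of_primes_plus by auto
qed

theorem corollary3:
  "{p \<in> zero_divs. prime_elem p} =
     {u * (1 + jj) | u. u dvd 1} \<union> {u * (1 - jj) | u. u dvd 1} \<and>
   {p \<in> - zero_divs. prime_elem p} =
     {u * (of_int (x + 1) + jj * of_int x) | u x. u dvd 1 \<and> prime_elem (2 * x + 1 :: int)} \<union>
     {u * (of_int (x + 1) - jj * of_int x) | u x. u dvd 1 \<and> prime_elem (2 * x + 1 :: int)}"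
  \<comment> \<open>Once all four families are conditions on components, the primality criteria can
    be compared with them directly.\<close>
  unfolding associates_of_1_plus_jj associates_of_1_minus_jj
    associates_of_primes_plus associates_of_primes_minus
proof
  show "{p \<in> zero_divs. prime_elem p} = {p. comp_minus p = 0 \<and> \<bar>comp_plus p\<bar> = 2} \<union>
      {p. comp_plus p = 0 \<and> \<bar>comp_minus p\<bar> = 2}"
    by (auto simp: zero_divs_comp_iff prime_elem_iff_comp_minus_0 prime_elem_iff_comp_plus_0)
  show "{p \<in> - zero_divs. prime_elem p} = {p. \<bar>comp_minus p\<bar> = 1 \<and> prime_elem (comp_plus p)} \<union>
      {p. \<bar>comp_plus p\<bar> = 1 \<and> prime_elem (comp_minus p)}" (is "?P = ?A \<union> ?B")
  proof (intro equalityI subsetI)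
    fix p assume "p \<in> ?P"
    then show "p \<in> ?A \<union> ?B"
      using prime_elem_comp_unit[of p] prime_elem_iff_comp_minus_1[of p]
        prime_elem_iff_comp_plus_1[of p]
      by (auto simp: zero_divs_comp_iff)
  next
    fix p assume "p \<in> ?A \<union> ?B"
    \<comment> \<open>One component is a sign and the other a prime, so neither vanishes and
      \<open>p\<close> is not a zero divisor.\<close>
    then show "p \<in> ?P"
      using prime_elem_iff_comp_minus_1[of p] prime_elem_iff_comp_plus_1[of p]
      by (auto simp: zero_divs_comp_iff prime_elem_def)
  qed
qed

end
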